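(* There is a unimodular lattice $L$ in dimension $37$ having minimum norm $3$ with $\sigma(L)=21$.
   Context: A (Euclidean) lattice $L \subset \mathbb{R}^n$ in dimension $n$ (i.e. of full rank $n$) is unimodular if $L=L^*$, where $L^*=\{x\in\mathbb{R}^n \mid (x,y)\in\mathbb{Z}\text{ for all }y\in L\}$ and $(x,y)$ is the standard inner product. The norm of a vector $x$ is $(x,x)$ (the squared length), and the minimum norm $\min(L)$ is the smallest norm of a nonzero vector of $L$. A unimodular lattice is even if all its vectors have even norm, and odd otherwise; even unimodular lattices exist only in dimensions divisible by $8$, so a unimodular lattice in dimension $37$ is odd. For an odd unimodular lattice $L$, the even sublattice is $L_0=\{x\in L\mid (x,x)\in 2\mathbb{Z}\}$, the shadow is $S(L)=L_0^*\setminus L$, and $\sigma(L)=4\min(S(L))$, where $\min(S(L))$ is the minimum norm of a vector in $S(L)$. *)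

theory Defs
  imports "HOL-Analysis.Analysis"
begin

text \<open>Throughout, the norm of a vector \<open>x\<close> is the squared length \<open>x \<bullet> x\<close>, not the
  library's \<open>norm x\<close>.\<close>

definition euclidean_lattice :: "'a::euclidean_space set \<Rightarrow> bool" where
  "euclidean_lattice L \<longleftrightarrow>
     (\<exists>B. independent B \<and> span B = UNIV \<and>
          L = {\<Sum>b\<in>B. of_int (c b) *\<^sub>R b | c :: 'a \<Rightarrow> int. True})"

definition dual_lattice :: "'a::euclidean_space set \<Rightarrow> 'a set" where
  "dual_lattice L = {x. \<forall>y\<in>L. x \<bullet> y \<in> \<int>}"

definition unimodular_lattice :: "'a::euclidean_space set \<Rightarrow> bool" where
  "unimodular_lattice L \<longleftrightarrow> euclidean_lattice L \<and> L = dual_lattice L"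

text \<open>\<open>LEAST\<close> denotes an attained minimum; its value is unspecified if there is none.\<close>

definition least_norm :: "'a::euclidean_space set \<Rightarrow> real" where
  "least_norm S = (LEAST r. \<exists>x\<in>S. r = x \<bullet> x)"

definition min_norm :: "'a::euclidean_space set \<Rightarrow> real" where
  "min_norm L = least_norm (L - {0})"

definition even_sublattice :: "'a::euclidean_space set \<Rightarrow> 'a set" where
  "even_sublattice L = {x \<in> L. \<exists>k::int. x \<bullet> x = 2 * of_int k}"

text \<open>The following two notions are meaningful for odd unimodular \<open>L\<close> only; for even
  unimodular \<open>L\<close> the set below is empty.\<close>

definition shadow :: "'a::euclidean_space set \<Rightarrow> 'a set" where
  "shadow L = dual_lattice (even_sublattice L) - L"

definition shadow_sigma :: "'a::euclidean_space set \<Rightarrow> real" where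
  "shadow_sigma L = 4 * least_norm (shadow L)"

end

theory Submission
  imports Defs
begin

text \<open>The lattice is \<open>L = {z/2 | z mod 4 \<in> C}\<close> for a self-dual \<open>\<int>\<^sub>4\<close>-code \<open>C\<close> of length 37 whose residue
  code \<open>C\<^sub>1\<close> is binary with nonzero weights 12, 16, 20 and has distinct nonzero columns. A vector of \<open>L\<close>
  with nonzero residue has at least 12 half-odd coordinates, hence norm at least 3; a nonzero vector with
  zero residue is integral and orthogonal to \<open>C\<^sub>1\<close> modulo 2, and has norm at least 3 because the
  dual code of \<open>C\<^sub>1\<close> has minimum distance 3. A shadow vector is half an integer vector \<open>t\<close> that is congruent
  modulo 2 to the complement of a word of \<open>C\<^sub>1\<close>. So \<open>t\<close> has at least \<open>37 - 20 = 17\<close> odd entries, and since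
  the norm of \<open>t\<close> is 5 modulo 8, it is at least 21.\<close>

section \<open>Lattice bases\<close>

lemma scaleR_int_mem:
  fixes M :: "'a::real_vector set"
  assumes "0 \<in> M" and diff: "\<And>x y. x \<in> M \<Longrightarrow> y \<in> M \<Longrightarrow> x - y \<in> M" and "x \<in> M"
  shows "of_int k *\<^sub>R x \<in> M"
proof -
  have neg: "- y \<in> M" if "y \<in> M" for y
    using diff[OF \<open>0 \<in> M\<close> that] by simp
  have add: "y + z \<in> M" if "y \<in> M" "z \<in> M" for y z
    using diff[OF that(1) neg[OF that(2)]] by simp
  have nat: "of_nat n *\<^sub>R x \<in> M" for n
    by (induction n) (use assms add in \<open>auto simp: scaleR_add_left\<close>)
  show ?thesis
    by (cases k rule: int_cases2) (use nat neg in auto)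
qed

text \<open>Hermite reduction, one coordinate at a time. The values of coordinate \<open>k\<close>
  on \<open>M\<close> form a subgroup of \<open>(1/d) Z\<close>, generated by its least positive
  element. A vector \<open>x0\<close> attaining it, together with generators of the part of
  \<open>M\<close> vanishing at \<open>k\<close>, generates \<open>M\<close>.\<close>

lemma echelon_basis:
  fixes M :: "(real ^ 'n) set" and N d :: int
  assumes "finite T" "N > 0" "d > 0"
    and "0 \<in> M" "\<And>x y. x \<in> M \<Longrightarrow> y \<in> M \<Longrightarrow> x - y \<in> M"
    and "\<And>i. i \<in> T \<Longrightarrow> axis i (of_int N) \<in> M"
    and "\<And>x i. x \<in> M \<Longrightarrow> of_int d * x $ i \<in> \<int>"
    and "\<And>x i. x \<in> M \<Longrightarrow> i \<notin> T \<Longrightarrow> x $ i = 0"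
  shows "\<exists>b. \<forall>x. x \<in> M \<longleftrightarrow> (\<exists>c::'n \<Rightarrow> int. x = (\<Sum>i\<in>T. of_int (c i) *\<^sub>R b i))"
  using assms
proof (induction T arbitrary: M rule: finite_induct)
  case empty
  then have "M = {0}"
    by (auto simp: vec_eq_iff)
  then show ?case by auto
next
  case (insert k T)
  note diff = insert.prems(4)
  note mult = scaleR_int_mem[OF insert.prems(3) diff]
  define M' where "M' = {x \<in> M. x $ k = 0}"
  have "\<exists>b. \<forall>x. x \<in> M' \<longleftrightarrow> (\<exists>c::'n \<Rightarrow> int. x = (\<Sum>i\<in>T. of_int (c i) *\<^sub>R b i))"
  proof (rule insert.IH)
    show "x $ i = 0" if "x \<in> M'" "i \<notin> T" for x i
      using that insert.prems(7)[of x i] by (cases "i = k") (auto simp: M'_def)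
    show "axis i (of_int N) \<in> M'" if "i \<in> T" for i
      using that insert.prems(5)[of i] insert.hyps(2) by (auto simp: M'_def axis_def)
  qed (use insert.prems in \<open>auto simp: M'_def\<close>)
  then obtain b where b: "\<And>x. x \<in> M' \<longleftrightarrow> (\<exists>c::'n \<Rightarrow> int. x = (\<Sum>i\<in>T. of_int (c i) *\<^sub>R b i))"
    by blast
  define Q where "Q = (\<lambda>q::nat. q > 0 \<and> (\<exists>x\<in>M. of_int d * x $ k = of_nat q))"
  \<comment> \<open>The vector \<open>axis k (of_int N)\<close> provides a positive value.\<close>
  have "Q (nat (d * N))"
    unfolding Q_def using insert.prems(1,2) insert.prems(5)[of k]
    by (auto intro!: bexI[of _ "axis k (of_int N)"])
  then have "Q (LEAST q. Q q)" by (rule LeastI)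
  then obtain q x0 where q: "q = (LEAST q. Q q)" "q > 0" and x0: "x0 \<in> M" "of_int d * x0 $ k = of_nat q"
    unfolding Q_def by auto
  have reduce: "\<exists>c. x - of_int c *\<^sub>R x0 \<in> M'" if x: "x \<in> M" for x
  proof -
    obtain z where z: "of_int d * x $ k = of_int z"
      using insert.prems(6)[OF x, of k] by (auto elim: Ints_cases)
    define y where "y = x - of_int (z div int q) *\<^sub>R x0"
    have y: "y \<in> M" unfolding y_def by (intro diff x mult x0)
    have "of_int d * y $ k = of_int z - of_int (z div int q) * (of_int d * x0 $ k)"
      using z by (simp add: y_def algebra_simps)
    also have "\<dots> = of_int (z - z div int q * int q)"
      using x0 by simp
    also have "z - z div int q * int q = z mod int q"
      by (simp add: minus_div_mult_eq_mod)
    finally have yk: "of_int d * y $ k = of_int (z mod int q)" .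
    \<comment> \<open>A nonzero remainder would be a positive value smaller than
      \<open>q\<close>.\<close>
    have "z mod int q = 0"
    proof (rule ccontr)
      assume "z mod int q \<noteq> 0"
      with q have "z mod int q > 0"
        using pos_mod_sign[of "int q" z] by linarith
      then have "Q (nat (z mod int q))"
        using y yk unfolding Q_def by (auto intro!: bexI[of _ y])
      then have "q \<le> nat (z mod int q)"
        unfolding q by (rule Least_le)
      moreover have "z mod int q < int q" using q by simp
      ultimately show False using \<open>z mod int q > 0\<close> by linarith
    qed
    with yk insert.prems(2) have "y $ k = 0" by simp
    with y show ?thesis unfolding M'_def y_def by blast
  qed
  have "x \<in> M \<longleftrightarrow> (\<exists>c::'n \<Rightarrow> int. x = (\<Sum>i\<in>insert k T. of_int (c i) *\<^sub>R (b(k := x0)) i))" for x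
  proof
    assume "x \<in> M"
    then obtain c where "x - of_int c *\<^sub>R x0 \<in> M'" using reduce by blast
    then obtain c' where "x - of_int c *\<^sub>R x0 = (\<Sum>i\<in>T. of_int (c' i) *\<^sub>R b i)"
      using b by blast
    then have "x = of_int c *\<^sub>R x0 + (\<Sum>i\<in>T. of_int (c' i) *\<^sub>R b i)"
      by (simp add: algebra_simps)
    also have "\<dots> = (\<Sum>i\<in>insert k T. of_int ((c'(k := c)) i) *\<^sub>R (b(k := x0)) i)"
      using insert.hyps by (auto intro!: sum.cong)
    finally show "\<exists>c::'n \<Rightarrow> int. x = (\<Sum>i\<in>insert k T. of_int (c i) *\<^sub>R (b(k := x0)) i)"
      by blast
  next
    assume "\<exists>c::'n \<Rightarrow> int. x = (\<Sum>i\<in>insert k T. of_int (c i) *\<^sub>R (b(k := x0)) i)"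
    then obtain c :: "'n \<Rightarrow> int"
      where c: "x = (\<Sum>i\<in>insert k T. of_int (c i) *\<^sub>R (b(k := x0)) i)" by blast
    have "x = of_int (c k) *\<^sub>R x0 + (\<Sum>i\<in>T. of_int (c i) *\<^sub>R (b(k := x0)) i)"
      using c insert.hyps by simp
    also have "(\<Sum>i\<in>T. of_int (c i) *\<^sub>R (b(k := x0)) i) = (\<Sum>i\<in>T. of_int (c i) *\<^sub>R b i)"
      using insert.hyps by (intro sum.cong) auto
    finally have "x = (\<Sum>i\<in>T. of_int (c i) *\<^sub>R b i) - of_int (- c k) *\<^sub>R x0"
      by simp
    moreover have "(\<Sum>i\<in>T. of_int (c i) *\<^sub>R b i) \<in> M"
      using b unfolding M'_def by blast
    ultimately show "x \<in> M"
      using diff mult x0 by metis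
  qed
  then show ?case by (intro exI[of _ "b(k := x0)"] allI)
qed

text \<open>The echelon family spans because it generates every \<open>axis i (of_int N)\<close>.
  Being indexed by the coordinates, it then consists of distinct vectors and is independent.\<close>

lemma euclidean_latticeI:
  fixes M :: "(real ^ 'n) set" and N d :: int
  assumes "N > 0" "d > 0"
    and "0 \<in> M" "\<And>x y. x \<in> M \<Longrightarrow> y \<in> M \<Longrightarrow> x - y \<in> M"
    and axis: "\<And>i. axis i (of_int N) \<in> M"
    and "\<And>x i. x \<in> M \<Longrightarrow> of_int d * x $ i \<in> \<int>"
  shows "euclidean_lattice M"
proof -
  obtain b where b: "\<And>x. x \<in> M \<longleftrightarrow> (\<exists>c::'n \<Rightarrow> int. x = (\<Sum>i\<in>UNIV. of_int (c i) *\<^sub>R b i))"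
    using echelon_basis[of UNIV N d M] assms by auto
  have span: "span (range b) = UNIV"
  proof -
    have "axis i 1 \<in> span (range b)" for i
    proof -
      obtain c :: "'n \<Rightarrow> int" where "axis i (of_int N) = (\<Sum>i\<in>UNIV. of_int (c i) *\<^sub>R b i)"
        using axis b by blast
      then have "axis i (of_int N) \<in> span (range b)"
        by (simp add: span_sum span_mul span_base)
      then have "inverse (of_int N) *\<^sub>R axis i (of_int N) \<in> span (range b)"
        by (rule span_mul)
      also have "inverse (of_int N) *\<^sub>R axis i (of_int N) = (axis i 1 :: real ^ 'n)"
        using \<open>N > 0\<close> by (auto simp: vec_eq_iff axis_def)
      finally show ?thesis .
    qed
    then have "Basis \<subseteq> span (range b)"
      by (auto simp: Basis_vec_def)
    then show ?thesis
      using span_mono span_span span_Basis by (metis top.extremum_uniqueI)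
  qed
  have "card (range b) \<ge> CARD('n)"
    using dim_le_card'[of "range b"] span by (metis DIM_cart DIM_real dim_UNIV dim_span finite finite_imageI mult.right_neutral)
  then have card: "card (range b) = CARD('n)"
    using card_image_le[of UNIV b] by simp
  then have inj: "inj b"
    by (intro eq_card_imp_inj_on) auto
  have indep: "independent (range b)"
    using card_le_dim_spanning[of "range b" UNIV] span card by (simp add: dim_UNIV)
  have "M = {\<Sum>v\<in>range b. of_int (c v) *\<^sub>R v | c :: real ^ 'n \<Rightarrow> int. True}"
  proof (intro set_eqI iffI)
    fix x assume "x \<in> M"
    then obtain c :: "'n \<Rightarrow> int" where "x = (\<Sum>i\<in>UNIV. of_int (c i) *\<^sub>R b i)"
      using b by blast
    also have "\<dots> = (\<Sum>v\<in>range b. of_int ((c \<circ> inv b) v) *\<^sub>R v)"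
      using inj by (simp add: sum.reindex)
    finally show "x \<in> {\<Sum>v\<in>range b. of_int (c v) *\<^sub>R v | c :: real ^ 'n \<Rightarrow> int. True}"
      by blast
  next
    fix x assume "x \<in> {\<Sum>v\<in>range b. of_int (c v) *\<^sub>R v | c :: real ^ 'n \<Rightarrow> int. True}"
    then obtain c :: "real ^ 'n \<Rightarrow> int" where "x = (\<Sum>v\<in>range b. of_int (c v) *\<^sub>R v)"
      by blast
    also have "\<dots> = (\<Sum>i\<in>UNIV. of_int ((c \<circ> b) i) *\<^sub>R b i)"
      using inj by (simp add: sum.reindex)
    finally show "x \<in> M" using b by blast
  qed
  then show ?thesis
    unfolding euclidean_lattice_def using indep span by blast
qed

section \<open>Shadows\<close>

lemma least_norm_eqI:
  assumes "x \<in> S" "x \<bullet> x = r" "\<And>y. y \<in> S \<Longrightarrow> r \<le> y \<bullet> y"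
  shows "least_norm S = r"
  unfolding least_norm_def by (rule Least_equality) (use assms in auto)

lemma half_integers_diff:
  fixes r :: real
  assumes "2 * r \<in> \<int>" "r \<notin> \<int>" "2 * s \<in> \<int>" "s \<notin> \<int>"
  shows "r - s \<in> \<int>"
proof -
  obtain m n where m: "2 * r = of_int m" and n: "2 * s = of_int n"
    using assms by (auto elim!: Ints_cases)
  have "odd m" "odd n"
    using m n assms(2,4) by (auto elim!: evenE)
  then have "even (m - n)" by simp
  then obtain j where "m - n = 2 * j" by blast
  then have "of_int m - of_int n = (2 * of_int j :: real)"
    by (metis of_int_diff of_int_mult of_int_numeral)
  then have "r - s = of_int j" using m n by simp
  then show ?thesis by simp
qed

text \<open>Modulo 1, the product with \<open>w\<close> is a homomorphism that kills the even
  sublattice but not all of \<open>L\<close>, since \<open>w\<close> lies outside \<open>L\<close>,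
  which is its own dual. Any two vectors of odd norm differ by an element of the even sublattice, so
  the product is half-odd on all of them, just like half the norm.\<close>

lemma shadow_characteristic:
  assumes diff: "\<And>x y. x \<in> L \<Longrightarrow> y \<in> L \<Longrightarrow> x - y \<in> L"
    and L: "L = dual_lattice L" and w: "w \<in> shadow L" and x: "x \<in> L"
  shows "w \<bullet> x - (x \<bullet> x) / 2 \<in> \<int>"
proof -
  have int: "y \<bullet> z \<in> \<int>" if "y \<in> L" "z \<in> L" for y z
    using that L unfolding dual_lattice_def by blast
  have "0 \<in> L" using diff[OF x x] by simp
  have add: "y + z \<in> L" if "y \<in> L" "z \<in> L" for y z
    using diff[OF that(1) diff[OF \<open>0 \<in> L\<close> that(2)]] by simp
  have even: "w \<bullet> y \<in> \<int>" if y: "y \<in> L" "(y \<bullet> y) / 2 \<in> \<int>" for y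
  proof -
    obtain k where "(y \<bullet> y) / 2 = of_int k" using y(2) by (auto elim: Ints_cases)
    then have "y \<in> even_sublattice L"
      using y(1) unfolding even_sublattice_def by (auto intro!: exI[of _ k])
    then show ?thesis using w unfolding shadow_def dual_lattice_def by blast
  qed
  \<comment> \<open>The norm of \<open>y + y\<close> is four times that of \<open>y\<close>, so
    \<open>y + y\<close> is in the even sublattice.\<close>
  have double: "2 * (w \<bullet> y) \<in> \<int>" if "y \<in> L" for y
  proof -
    have "(y + y) \<bullet> (y + y) / 2 = 2 * (y \<bullet> y)"
      by (simp add: inner_add_left inner_add_right)
    then have "w \<bullet> (y + y) \<in> \<int>"
      using int[OF that that] by (intro even add that) auto
    then show ?thesis by (simp add: inner_add_right)
  qed
  obtain x0 where x0: "x0 \<in> L" "w \<bullet> x0 \<notin> \<int>"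
    using w L unfolding shadow_def dual_lattice_def by blast
  show ?thesis
  proof (cases "(x \<bullet> x) / 2 \<in> \<int>")
    case True
    then show ?thesis using even[OF x True] by auto
  next
    case odd: False
    have odd0: "(x0 \<bullet> x0) / 2 \<notin> \<int>" using even x0 by blast
    have "(x \<bullet> x) / 2 - (x0 \<bullet> x0) / 2 \<in> \<int>"
      using int[OF x x] int[OF x0(1) x0(1)] by (intro half_integers_diff odd odd0) simp_all
    then have "((x \<bullet> x) / 2 - (x0 \<bullet> x0) / 2) - (x - x0) \<bullet> x0 \<in> \<int>"
      by (rule Ints_diff) (intro int diff x x0)
    moreover have "(x - x0) \<bullet> (x - x0) / 2 =
        ((x \<bullet> x) / 2 - (x0 \<bullet> x0) / 2) - (x - x0) \<bullet> x0"
      by (simp add: inner_diff_left inner_diff_right inner_commute field_simps)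
    ultimately have "w \<bullet> (x - x0) \<in> \<int>"
      by (intro even diff x x0) (simp only:)
    then have "w \<bullet> x \<notin> \<int>"
      using x0 Ints_diff[of "w \<bullet> x" "w \<bullet> (x - x0)"] by (auto simp: inner_diff_right)
    then show ?thesis
      using int[OF x x] double[OF x] by (intro half_integers_diff odd) simp_all
  qed
qed

text \<open>Converse of \<open>shadow_characteristic\<close>. The vector \<open>x\<close> of odd
  norm has a non-integral product with \<open>w\<close>, which keeps \<open>w\<close> out of the
  self-dual \<open>L\<close>.\<close>

lemma shadowI:
  assumes L: "L = dual_lattice L"
    and char: "\<And>x. x \<in> L \<Longrightarrow> w \<bullet> x - (x \<bullet> x) / 2 \<in> \<int>"
    and x: "x \<in> L" "(x \<bullet> x) / 2 \<notin> \<int>"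
  shows "w \<in> shadow L"
proof -
  have "w \<bullet> y \<in> \<int>" if y: "y \<in> even_sublattice L" for y
  proof -
    obtain k where "y \<in> L" "y \<bullet> y = 2 * of_int k"
      using y unfolding even_sublattice_def by blast
    with char[of y] show ?thesis
      using Ints_add[of "w \<bullet> y - (y \<bullet> y) / 2" "of_int k"] by simp
  qed
  moreover have "w \<notin> L"
  proof
    assume "w \<in> L"
    then have "w \<bullet> x \<in> \<int>" using L x unfolding dual_lattice_def by blast
    with char[OF x(1)] have "w \<bullet> x - (w \<bullet> x - (x \<bullet> x) / 2) \<in> \<int>" by (rule Ints_diff[rotated])
    with x show False by simp
  qed
  ultimately show ?thesis unfolding shadow_def dual_lattice_def by blast
qed

section \<open>Integer squares: parity and residues modulo 8\<close>

lemma sum_squares_ge_card_odd: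
  fixes t :: "'a::finite \<Rightarrow> int"
  shows "int (card {i. odd (t i)}) \<le> (\<Sum>i\<in>UNIV. (t i)\<^sup>2)"
proof -
  have "int (card {i. odd (t i)}) = (\<Sum>i\<in>{i. odd (t i)}. 1)" by simp
  also have "\<dots> \<le> (\<Sum>i\<in>{i. odd (t i)}. (t i)\<^sup>2)"
  proof (rule sum_mono)
    fix i assume "i \<in> {i. odd (t i)}"
    then have "t i \<noteq> 0" by auto
    then show "1 \<le> (t i)\<^sup>2" using zero_less_power2[of "t i"] by linarith
  qed
  also have "\<dots> \<le> (\<Sum>i\<in>UNIV. (t i)\<^sup>2)" by (rule sum_mono2) auto
  finally show ?thesis .
qed

lemma odd_square_mod_8:
  fixes a :: int
  assumes "odd a"
  shows "a\<^sup>2 mod 8 = 1"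
proof -
  obtain b where b: "a = 2 * b + 1" using assms by (elim oddE)
  have "even (b * (b + 1))" by auto
  then obtain c where "b * (b + 1) = 2 * c" by blast
  then have "a\<^sup>2 = 1 + 8 * c" using b by (simp add: power2_eq_square algebra_simps)
  then show ?thesis by simp
qed

lemma sum_odd_squares_mod_8:
  fixes t :: "'a::finite \<Rightarrow> int"
  assumes "\<And>i. odd (t i)"
  shows "(\<Sum>i\<in>UNIV. (t i)\<^sup>2) mod 8 = int CARD('a) mod 8"
proof -
  have "(\<Sum>i\<in>UNIV. (t i)\<^sup>2) mod 8 = (\<Sum>i\<in>UNIV. (t i)\<^sup>2 mod 8) mod 8"
    by (simp add: mod_sum_eq)
  also have "\<dots> = int CARD('a) mod 8"
    using assms by (simp add: odd_square_mod_8)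
  finally show ?thesis .
qed

section \<open>Unimodular lattices from self-dual \<open>\<int>\<^sub>4\<close>-codes\<close>

definition dot :: "('n::finite \<Rightarrow> int) \<Rightarrow> ('n \<Rightarrow> int) \<Rightarrow> int" where
  "dot s t = (\<Sum>i\<in>UNIV. s i * t i)"

definition ivec :: "('n::finite \<Rightarrow> int) \<Rightarrow> real ^ 'n" where
  "ivec t = (\<chi> i. of_int (t i))"

lemma dot_commute: "dot s t = dot t s"
  by (simp add: dot_def mult.commute)

lemma dot_add_right: "dot s (\<lambda>i. t i + u i) = dot s t + dot s u"
  by (simp add: dot_def distrib_left sum.distrib)

lemma dot_add_left: "dot (\<lambda>i. t i + u i) s = dot t s + dot u s"
  by (simp add: dot_def distrib_right sum.distrib)

lemma dot_diff_right: "dot s (\<lambda>i. t i - u i) = dot s t - dot s u"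
  by (simp add: dot_def right_diff_distrib sum_subtractf)

lemma dot_cmult_right: "dot s (\<lambda>i. c * t i) = c * dot s t"
  by (simp add: dot_def sum_distrib_left mult.left_commute)

lemma dot_cmult_left: "dot (\<lambda>i. c * t i) s = c * dot t s"
  by (simp add: dot_def sum_distrib_left mult.assoc)

lemma dot_sum_right: "dot s (\<lambda>i. \<Sum>a\<in>A. f a i) = (\<Sum>a\<in>A. dot s (f a))"
  unfolding dot_def sum_distrib_left by (rule sum.swap)

lemma dot_delta_right: "dot s (\<lambda>i. of_bool (i = j)) = s j"
  by (simp add: dot_def of_bool_def if_distrib cong: if_cong)

lemmas dot_linear = dot_add_left dot_add_right dot_diff_right dot_cmult_left dot_cmult_right
  dot_sum_right

lemma inner_ivec: "ivec s \<bullet> ivec t = of_int (dot s t)"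
  by (simp add: ivec_def dot_def inner_vec_def)

lemma inner_half_ivec: "((1/2) *\<^sub>R ivec s) \<bullet> ((1/2) *\<^sub>R ivec t) = of_int (dot s t) / 4"
  by (simp add: inner_ivec)

lemma of_int_divide_in_Ints_iff:
  "(of_int a / of_int b :: real) \<in> \<int> \<longleftrightarrow> b dvd a" if "b \<noteq> 0"
proof
  assume "(of_int a / of_int b :: real) \<in> \<int>"
  then obtain c where "of_int a / of_int b = (of_int c :: real)" by (elim Ints_cases)
  then have "(of_int a :: real) = of_int (b * c)" using that by (simp add: field_simps)
  then show "b dvd a" by (metis dvd_triv_left of_int_eq_iff)
qed (use that in auto)

lemma half_ivecI:
  assumes "\<And>i. 2 * x $ i \<in> \<int>"
  obtains t where "x = (1/2) *\<^sub>R ivec t"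
proof
  show "x = (1/2) *\<^sub>R ivec (\<lambda>i. \<lfloor>2 * x $ i\<rfloor>)"
    using assms by (simp add: vec_eq_iff ivec_def)
qed

lemma card_odd_le_dot: "int (card {i. odd (t i)}) \<le> dot t t"
  using sum_squares_ge_card_odd[of t] by (simp add: dot_def power2_eq_square)

lemma even_dot_iff: "even (dot s t) \<longleftrightarrow> even (\<Sum>i | odd (t i). s i)"
proof -
  have "(\<Sum>i | odd (t i). s i) = (\<Sum>i\<in>UNIV. if odd (t i) then s i else 0)"
    by (simp add: sum.If_cases)
  then have "dot s t - (\<Sum>i | odd (t i). s i) = (\<Sum>i\<in>UNIV. s i * t i - (if odd (t i) then s i else 0))"
    by (simp add: dot_def sum_subtractf)
  also have "even \<dots>" by (intro dvd_sum) auto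
  finally show ?thesis by auto
qed

text \<open>Each \<open>u i * (u i + 1)\<close> is even, so modulo 2 the norm of \<open>u\<close> is
  the sum of its entries. This makes the characteristic condition on doubled vectors linear.\<close>

lemma even_dot_self: "even (dot s u - dot u u) \<longleftrightarrow> even (dot (\<lambda>i. s i + 1) u)"
proof -
  have "dot (\<lambda>i. s i + 1) u - (dot s u - dot u u) = (\<Sum>i\<in>UNIV. u i * (u i + 1))"
    by (simp add: dot_def sum_subtractf[symmetric] sum.distrib[symmetric] algebra_simps)
  also have "even \<dots>" by (intro dvd_sum) auto
  finally show ?thesis by presburger
qed

text \<open>The rows \<open>G a\<close> lift a basis of the residue code to \<open>\<int>\<^sub>4\<close>; \<open>words\<close> is the preimage in
  \<open>\<int>\<^sup>n\<close> of the self-dual \<open>\<int>\<^sub>4\<close>-code with that residue code.\<close>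

locale z4_code =
  fixes G :: "nat \<Rightarrow> 'n::finite \<Rightarrow> int" and k :: nat and piv :: "nat \<Rightarrow> 'n"
  assumes orth: "a < k \<Longrightarrow> b < k \<Longrightarrow> 4 dvd dot (G a) (G b)"
    and piv: "a < k \<Longrightarrow> b < k \<Longrightarrow> G a (piv b) = of_bool (a = b)"
begin

definition comb :: "(nat \<Rightarrow> int) \<Rightarrow> 'n \<Rightarrow> int" where
  "comb m i = (\<Sum>a<k. m a * G a i)"

text \<open>The binary dual of the residue code.\<close>

definition torsion :: "('n \<Rightarrow> int) \<Rightarrow> bool" where
  "torsion u \<longleftrightarrow> (\<forall>a<k. even (dot (G a) u))"

definition words :: "('n \<Rightarrow> int) set" where
  "words = {\<lambda>i. comb m i + 2 * u i | m u. torsion u}"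

text \<open>Construction A modulo 4: with the factor 1/2, divisibility of \<open>dot\<close> by 4
  becomes integrality of the inner product.\<close>

definition lattice :: "(real ^ 'n) set" where
  "lattice = (\<lambda>z. (1/2) *\<^sub>R ivec z) ` words"

lemma dot_comb_right: "dot s (comb m) = (\<Sum>a<k. m a * dot s (G a))"
  unfolding comb_def by (simp add: dot_linear)

lemma wordsI: "torsion u \<Longrightarrow> (\<lambda>i. comb m i + 2 * u i) \<in> words"
  unfolding words_def by blast

lemma comb_in_words: "comb m \<in> words"
  using wordsI[of "\<lambda>_. 0" m] by (simp add: torsion_def dot_def)

lemma double_in_words: "torsion u \<Longrightarrow> (\<lambda>i. 2 * u i) \<in> words"
  using wordsI[of u "\<lambda>_. 0"] by (simp add: comb_def)

lemma row_in_words: "a < k \<Longrightarrow> G a \<in> words"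
proof -
  assume "a < k"
  then have "comb (\<lambda>b. of_bool (b = a)) = G a"
    by (simp add: comb_def fun_eq_iff of_bool_def if_distrib if_distribR cong: if_cong)
  then show ?thesis using comb_in_words by metis
qed

lemma dot_row_words:
  assumes "a < k" "z \<in> words"
  shows "4 dvd dot (G a) z"
proof -
  obtain m u where z: "z = (\<lambda>i. comb m i + 2 * u i)" "torsion u"
    using assms(2) unfolding words_def by blast
  then have "even (dot (G a) u)" using assms(1) by (simp add: torsion_def)
  then have "4 dvd 2 * dot (G a) u" by auto
  moreover have "4 dvd (\<Sum>b<k. m b * dot (G a) (G b))"
    using orth assms(1) by (intro dvd_sum dvd_mult) auto
  ultimately show ?thesis
    unfolding z(1) by (simp add: dot_linear dot_comb_right)
qed

lemma even_torsion_comb: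
  assumes "torsion u"
  shows "even (dot u (comb m))"
  unfolding dot_comb_right
  by (intro dvd_sum) (use assms in \<open>auto simp: torsion_def dot_commute[of u]\<close>)

lemma words_orth:
  assumes "z \<in> words" "z' \<in> words"
  shows "4 dvd dot z z'"
proof -
  obtain m u where z: "z' = (\<lambda>i. comb m i + 2 * u i)" "torsion u"
    using assms unfolding words_def by blast
  obtain m' u' where z': "z = (\<lambda>i. comb m' i + 2 * u' i)" "torsion u'"
    using assms unfolding words_def by blast
  have "even (dot z u)"
    unfolding z'(1) using even_torsion_comb[OF z(2)] by (simp add: dot_linear dot_commute)
  then have "4 dvd 2 * dot z u" by auto
  moreover have "4 dvd (\<Sum>b<k. m b * dot z (G b))"
    using dot_row_words assms(1) by (intro dvd_sum dvd_mult) (auto simp: dot_commute)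
  ultimately show ?thesis
    unfolding z(1) by (simp add: dot_linear dot_comb_right)
qed

lemma words_diff:
  assumes "z \<in> words" "z' \<in> words"
  shows "(\<lambda>i. z i - z' i) \<in> words"
proof -
  obtain m u where z: "z = (\<lambda>i. comb m i + 2 * u i)" "torsion u"
    using assms unfolding words_def by blast
  obtain m' u' where z': "z' = (\<lambda>i. comb m' i + 2 * u' i)" "torsion u'"
    using assms unfolding words_def by blast
  have "torsion (\<lambda>i. u i - u' i)"
    using z(2) z'(2) by (simp add: torsion_def dot_linear)
  then have "(\<lambda>i. comb (\<lambda>a. m a - m' a) i + 2 * (u i - u' i)) \<in> words"
    by (rule wordsI)
  moreover have "(\<lambda>i. comb (\<lambda>a. m a - m' a) i + 2 * (u i - u' i)) = (\<lambda>i. z i - z' i)"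
    unfolding z z' by (simp add: comb_def fun_eq_iff left_diff_distrib sum_subtractf)
  ultimately show ?thesis by simp
qed

text \<open>\<open>check j\<close> is the parity check that expresses coordinate \<open>j\<close> of the residue code through
  the pivot coordinates.\<close>

definition check :: "'n \<Rightarrow> 'n \<Rightarrow> int" where
  "check j i = of_bool (i = j) - (\<Sum>a<k. G a j * of_bool (i = piv a))"

lemma dot_check: "dot s (check j) = s j - comb (\<lambda>a. s (piv a)) j"
  unfolding check_def dot_diff_right dot_sum_right dot_cmult_right dot_delta_right comb_def
  by (simp add: mult.commute)

text \<open>The pivot entries of row \<open>a\<close> form a unit vector, so \<open>comb\<close> of
  them returns the row itself and the product given by \<open>dot_check\<close> vanishes.\<close>

lemma torsion_check: "torsion (check j)"
  unfolding torsion_def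
proof (intro allI impI)
  fix a assume a: "a < k"
  have "comb (\<lambda>b. G a (piv b)) j = (\<Sum>b<k. of_bool (a = b) * G b j)"
    unfolding comb_def by (intro sum.cong) (use a piv in auto)
  also have "\<dots> = G a j"
    using a by (simp add: of_bool_def if_distrib if_distribR cong: if_cong)
  finally show "even (dot (G a) (check j))"
    by (simp add: dot_check)
qed

text \<open>Pairing \<open>z\<close> with the doubled checks shows that it agrees modulo 2 with the
  combination that has its pivot entries; pairing with the rows shows that half the difference is
  torsion.\<close>

lemma words_maximal:
  assumes z: "\<And>z'. z' \<in> words \<Longrightarrow> 4 dvd dot z z'"
  shows "z \<in> words"
proof -
  define m where "m = (\<lambda>a. z (piv a))"
  define u where "u = (\<lambda>i. (z i - comb m i) div 2)"
  have "even (z j - comb m j)" for j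
  proof -
    have "4 dvd 2 * (z j - comb m j)"
      using z[OF double_in_words[OF torsion_check[of j]]]
      by (simp only: dot_cmult_right dot_check m_def)
    then show ?thesis by presburger
  qed
  then have zu: "z = (\<lambda>i. comb m i + 2 * u i)"
    by (auto simp: fun_eq_iff u_def)
  have "even (dot (G a) u)" if a: "a < k" for a
  proof -
    have "4 dvd dot (G a) z" "4 dvd dot (G a) (comb m)"
      using z[OF row_in_words[OF a]] dot_row_words[OF a comb_in_words]
      by (auto simp: dot_commute)
    then have "4 dvd dot (G a) z - dot (G a) (comb m)" by (rule dvd_diff)
    also have "\<dots> = 2 * dot (G a) u" unfolding zu by (simp add: dot_linear)
    finally show ?thesis by presburger
  qed
  then show ?thesis unfolding zu by (intro wordsI) (simp add: torsion_def)
qed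

section \<open>The lattice of the code: unimodularity and minimum norm\<close>

lemma lattice_diff:
  assumes "x \<in> lattice" "y \<in> lattice"
  shows "x - y \<in> lattice"
proof -
  obtain s t where st: "s \<in> words" "t \<in> words"
    and "x = (1/2) *\<^sub>R ivec s" "y = (1/2) *\<^sub>R ivec t"
    using assms unfolding lattice_def by blast
  then have "x - y = (1/2) *\<^sub>R ivec (\<lambda>i. s i - t i)"
    by (simp add: vec_eq_iff ivec_def field_simps)
  with words_diff[OF st] show ?thesis unfolding lattice_def by blast
qed

text \<open>Multiples of 4 are words. Their halves give the lattice full rank and force dual vectors
  to have half-integral coordinates.\<close>

lemma axis_2_in_lattice: "axis i 2 \<in> lattice"
proof -
  have "torsion (\<lambda>j. 2 * of_bool (j = i))"
    by (simp add: torsion_def dot_linear)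
  then have "(\<lambda>j. 2 * (2 * of_bool (j = i))) \<in> words"
    by (rule double_in_words)
  moreover have "axis i 2 = (1/2) *\<^sub>R ivec (\<lambda>j. 2 * (2 * of_bool (j = i)))"
    by (simp add: vec_eq_iff ivec_def axis_def)
  ultimately show ?thesis unfolding lattice_def by blast
qed

lemma lattice_self_dual: "lattice = dual_lattice lattice"
proof (intro set_eqI iffI)
  fix x assume "x \<in> lattice"
  then show "x \<in> dual_lattice lattice"
    using words_orth of_int_divide_in_Ints_iff[of 4]
    by (auto simp: lattice_def dual_lattice_def inner_ivec)
next
  fix x assume x: "x \<in> dual_lattice lattice"
  have "2 * x $ i \<in> \<int>" for i
    using x axis_2_in_lattice[of i] unfolding dual_lattice_def
    by (force simp: inner_axis mult.commute)
  then obtain z where z: "x = (1/2) *\<^sub>R ivec z" by (rule half_ivecI) blast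
  have "4 dvd dot z z'" if "z' \<in> words" for z'
  proof -
    have "x \<bullet> ((1/2) *\<^sub>R ivec z') \<in> \<int>"
      using x that unfolding dual_lattice_def lattice_def by blast
    then show ?thesis
      using of_int_divide_in_Ints_iff[of 4 "dot z z'"] unfolding z inner_half_ivec by simp
  qed
  then show "x \<in> lattice" unfolding z lattice_def by (intro imageI words_maximal)
qed

lemma unimodular_lattice: "unimodular_lattice lattice"
  unfolding unimodular_lattice_def
proof
  show "euclidean_lattice lattice"
  proof (rule euclidean_latticeI[of 2 2])
    show "axis i (of_int 2) \<in> lattice" for i using axis_2_in_lattice by simp
    then show "0 \<in> lattice" using lattice_diff by fastforce
    show "of_int 2 * x $ i \<in> \<int>" if "x \<in> lattice" for x i
      using that by (auto simp: lattice_def ivec_def)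
  qed (auto intro: lattice_diff)
qed (rule lattice_self_dual)

text \<open>By \<open>nonzero\<close> and \<open>distinct\<close>, the rows form a parity-check
  matrix of the torsion code with nonzero, pairwise different columns modulo 2. So no torsion vector
  has exactly one or two odd entries.\<close>

lemma lattice_norm_ge_3:
  assumes weight: "\<And>m. card {i. odd (comb m i)} = 0 \<or> 12 \<le> card {i. odd (comb m i)}"
    and nonzero: "\<And>i. \<exists>a<k. odd (G a i)"
    and distinct: "\<And>i j. i \<noteq> j \<Longrightarrow> \<exists>a<k. odd (G a i + G a j)"
    and x: "x \<in> lattice" "x \<noteq> 0"
  shows "3 \<le> x \<bullet> x"
proof -
  obtain z where z: "z \<in> words" "x = (1/2) *\<^sub>R ivec z"
    using x(1) unfolding lattice_def by blast
  obtain m u where zm: "z = (\<lambda>i. comb m i + 2 * u i)"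
    using z(1) unfolding words_def by blast
  have "12 \<le> dot z z"
  proof (cases "card {i. odd (comb m i)} = 0")
    case False
    then have "12 \<le> card {i. odd (comb m i)}" using weight[of m] by linarith
    also have "{i. odd (comb m i)} = {i. odd (z i)}" by (simp add: zm)
    finally show ?thesis using card_odd_le_dot[of z] by linarith
  next
    case True
    define v where "v = (\<lambda>i. z i div 2)"
    have zv: "z = (\<lambda>i. 2 * v i)"
      using True by (auto simp: v_def zm fun_eq_iff)
    have even: "even (\<Sum>i | odd (v i). G a i)" if "a < k" for a
    proof -
      have "4 dvd 2 * dot (G a) v"
        using dot_row_words[OF that z(1)] by (simp only: zv dot_cmult_right)
      then have "even (dot (G a) v)" by presburger
      then show ?thesis by (rule iffD1[OF even_dot_iff])
    qed
    have "3 \<le> dot v v"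
    proof -
      consider "card {i. odd (v i)} = 0" | "card {i. odd (v i)} = 1" | "card {i. odd (v i)} = 2"
        | "card {i. odd (v i)} \<ge> 3" by linarith
      then show ?thesis
      proof cases
        case 1
        \<comment> \<open>All entries are even, so a nonzero one alone contributes at least
          4.\<close>
        obtain i where "v i \<noteq> 0"
          using x(2) z(2) by (force simp: zv ivec_def vec_eq_iff)
        moreover have "even (v i)" using 1 by auto
        ultimately obtain c where c: "v i = 2 * c" "c \<noteq> 0" by auto
        have "3 \<le> 4 * c\<^sup>2" using c(2) zero_less_power2[of c] by linarith
        also have "\<dots> = v i * v i" using c(1) by (simp add: power2_eq_square)
        also have "\<dots> \<le> dot v v"
          unfolding dot_def by (rule member_le_sum) auto
        finally show ?thesis .
      next
        case 2
        then obtain i where "{i. odd (v i)} = {i}" by (auto simp: card_1_singleton_iff)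
        with even nonzero[of i] show ?thesis by auto
      next
        case 3
        then obtain i j where "{i. odd (v i)} = {i, j}" "i \<noteq> j" by (auto simp: card_2_iff)
        with even distinct[of i j] show ?thesis by auto
      next
        case 4
        then show ?thesis using card_odd_le_dot[of v] by linarith
      qed
    qed
    then show ?thesis by (simp add: zv dot_linear)
  qed
  then show ?thesis unfolding z(2) inner_half_ivec by simp
qed

text \<open>Adding to \<open>t\<close> a word of the complementary residue class makes all entries odd and changes the
  norm by a multiple of 8.\<close>

lemma shadow_lattice:
  assumes w: "w \<in> shadow lattice"
  obtains t m where "w = (1/2) *\<^sub>R ivec t" "\<And>i. odd (t i + comb m i)"
    "dot t t mod 8 = int CARD('n) mod 8"
proof -
  have char: "w \<bullet> x - (x \<bullet> x) / 2 \<in> \<int>" if "x \<in> lattice" for x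
    using lattice_diff lattice_self_dual w that by (rule shadow_characteristic)
  have "2 * w $ i \<in> \<int>" for i
  proof -
    have "w \<bullet> axis i 2 - 2 \<in> \<int>"
      using char[OF axis_2_in_lattice[of i]] by (simp add: inner_axis_axis)
    then have "w \<bullet> axis i 2 - 2 + 2 \<in> \<int>" by (intro Ints_add) auto
    then show ?thesis by (simp add: inner_axis mult.commute)
  qed
  then obtain t where t: "w = (1/2) *\<^sub>R ivec t" by (rule half_ivecI) blast
  \<comment> \<open>The characteristic condition at half of \<open>z\<close>, with denominators
    cleared.\<close>
  have Q: "8 dvd 2 * dot t z - dot z z" if "z \<in> words" for z
  proof -
    have "(1/2) *\<^sub>R ivec z \<in> lattice" using that by (simp add: lattice_def)
    from char[OF this] have "of_int (2 * dot t z - dot z z) / of_int 8 \<in> (\<int> :: real set)"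
      unfolding t inner_half_ivec by (simp add: field_simps)
    then show ?thesis by (subst (asm) of_int_divide_in_Ints_iff) auto
  qed
  \<comment> \<open>The vector \<open>t + 1\<close> turns out orthogonal modulo 2 to every check,
    hence is a residue word modulo 2; \<open>m\<close> reads off its pivot entries.\<close>
  define m where "m = (\<lambda>a. t (piv a) + 1)"
  have odd: "odd (t j + comb m j)" for j
  proof -
    have "8 dvd 4 * (dot t (check j) - dot (check j) (check j))"
      using Q[OF double_in_words[OF torsion_check[of j]]] by (simp add: dot_linear algebra_simps)
    then have "even (dot t (check j) - dot (check j) (check j))" by presburger
    then have "even (dot (\<lambda>i. t i + 1) (check j))" by (rule iffD1[OF even_dot_self])
    then have "even (t j + 1 - comb m j)" by (simp only: dot_check m_def)
    then show ?thesis by auto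
  qed
  have "dot (\<lambda>i. t i + comb m i) (\<lambda>i. t i + comb m i) mod 8 = int CARD('n) mod 8"
    using sum_odd_squares_mod_8[of "\<lambda>i. t i + comb m i"] odd
    by (simp add: dot_def power2_eq_square)
  moreover have "dot (\<lambda>i. t i + comb m i) (\<lambda>i. t i + comb m i)
      = dot t t + 2 * dot t (comb m) + dot (comb m) (comb m)"
    by (simp add: dot_linear dot_commute)
  \<comment> \<open>This is the expression of \<open>Q\<close> at \<open>comb m\<close> plus twice a
    multiple of 4.\<close>
  moreover have "(2 * dot t (comb m) + dot (comb m) (comb m)) mod 8 = 0"
  proof -
    have "8 dvd 2 * dot t (comb m) + dot (comb m) (comb m)"
    using Q[OF comb_in_words[of m]] words_orth[OF comb_in_words[of m] comb_in_words[of m]]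
      by presburger
    then show ?thesis by simp
  qed
  ultimately have "dot t t mod 8 = int CARD('n) mod 8"
    using mod_add_right_eq[of "dot t t" "2 * dot t (comb m) + dot (comb m) (comb m)" 8]
    by (simp add: add.assoc)
  then show ?thesis by (rule that[OF t odd])
qed

text \<open>On words, \<open>2 * dot t z - dot z z\<close> is additive modulo 8, because the cross
  term is twice a multiple of 4. It thus suffices to test the rows, covered by \<open>row\<close>,
  and the doubled torsion vectors, covered by \<open>odd\<close>. The vector \<open>u0\<close>
  supplies a lattice vector of odd norm.\<close>

lemma in_shadow_latticeI:
  assumes row: "\<And>a. a < k \<Longrightarrow> 8 dvd 2 * dot t (G a) - dot (G a) (G a)"
    and odd: "\<And>i. odd (t i + comb m i)"
    and u0: "torsion u0" "odd (dot u0 u0)"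
  shows "(1/2) *\<^sub>R ivec t \<in> shadow lattice"
proof -
  define Q where "Q = (\<lambda>z. 2 * dot t z - dot z z)"
  have add: "8 dvd Q (\<lambda>i. y i + z i)"
    if "8 dvd Q y" "8 dvd Q z" "4 dvd dot y z" for y z
  proof -
    have "Q (\<lambda>i. y i + z i) = Q y + Q z - 2 * dot y z"
      by (simp add: Q_def dot_linear dot_commute algebra_simps)
    with that show ?thesis by presburger
  qed
  have scaled: "8 dvd Q (\<lambda>i. c * G a i)" if a: "a < k" for a c
  proof -
    have "even (c * (c - 1))" by auto
    then obtain d where d: "c * (c - 1) = 2 * d" by blast
    obtain e where e: "dot (G a) (G a) = 4 * e" using orth[OF a a] by blast
    have "Q (\<lambda>i. c * G a i) = c * Q (G a) - c * (c - 1) * dot (G a) (G a)"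
      by (simp add: Q_def dot_linear algebra_simps)
    also have "\<dots> = c * Q (G a) - 8 * (d * e)" unfolding d e by simp
    also have "8 dvd \<dots>" using row[OF a] by (simp add: Q_def)
    finally show ?thesis .
  qed
  have partial: "8 dvd Q (\<lambda>i. \<Sum>a<j. n a * G a i)" if "j \<le> k" for j n
    using that
  proof (induction j)
    case 0
    then show ?case by (simp add: Q_def dot_def)
  next
    case (Suc j)
    have "4 dvd dot (\<lambda>i. \<Sum>a<j. n a * G a i) (\<lambda>i. n j * G j i)"
      using Suc.prems orth
      by (subst dot_commute) (auto simp: dot_linear intro!: dvd_sum dvd_mult)
    with Suc show ?case by (simp add: add scaled)
  qed
  have Q: "8 dvd Q z" if zw: "z \<in> words" for z
  proof -
    obtain n u where z: "z = (\<lambda>i. comb n i + 2 * u i)" "torsion u"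
      using zw unfolding words_def by blast
    \<comment> \<open>All entries of \<open>t + 1 + comb m\<close> are even, and
      \<open>comb m\<close> is orthogonal to \<open>u\<close> modulo 2.\<close>
    have "even (dot u (\<lambda>i. t i + 1 + comb m i))"
      unfolding dot_def by (intro dvd_sum dvd_mult) (use odd in simp)
    then have "even (dot u (\<lambda>i. t i + 1))"
      using even_torsion_comb[OF z(2), of m] by (simp add: dot_linear)
    then have "even (dot t u - dot u u)"
      unfolding even_dot_self by (simp only: dot_commute)
    moreover have "Q (\<lambda>i. 2 * u i) = 4 * (dot t u - dot u u)"
      by (simp add: Q_def dot_linear)
    ultimately have "8 dvd Q (\<lambda>i. 2 * u i)" by presburger
    moreover have "8 dvd Q (comb n)"
      using partial[of k n] by (simp add: comb_def[abs_def])
    moreover have "4 dvd dot (comb n) (\<lambda>i. 2 * u i)"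
      by (intro words_orth comb_in_words double_in_words z)
    ultimately show ?thesis unfolding z(1) by (intro add)
  qed
  have "((1/2) *\<^sub>R ivec t) \<bullet> x - (x \<bullet> x) / 2 \<in> \<int>" if x: "x \<in> lattice" for x
  proof -
    obtain z where z: "z \<in> words" "x = (1/2) *\<^sub>R ivec z"
      using x unfolding lattice_def by blast
    have "of_int (Q z) / of_int 8 \<in> (\<int> :: real set)"
      using Q[OF z(1)] by (subst of_int_divide_in_Ints_iff) auto
    then show ?thesis
      unfolding z(2) inner_half_ivec by (simp add: Q_def field_simps)
  qed
  moreover have "(1/2) *\<^sub>R ivec (\<lambda>i. 2 * u0 i) \<in> lattice"
    using double_in_words[OF u0(1)] by (simp add: lattice_def)
  moreover have "((1/2) *\<^sub>R ivec (\<lambda>i. 2 * u0 i)) \<bullet> ((1/2) *\<^sub>R ivec (\<lambda>i. 2 * u0 i)) / 2 \<notin> \<int>"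
    using u0(2) of_int_divide_in_Ints_iff[of 2] unfolding inner_half_ivec by (simp add: dot_linear)
  ultimately show ?thesis using shadowI[OF lattice_self_dual] by blast
qed

end

section \<open>A doubly-even code of length 37\<close>

text \<open>\<open>columns\<close> lists the columns of a generator matrix of the residue code in binary: the 25
  nonzero points of the hyperplane \<open>bit 0 = 0\<close> of \<open>GF(2)\<^sup>6\<close> outside a frame of six points, and 12
  points off this hyperplane that come from the conference two-graph on six vertices. In \<open>entry\<close>
  one 1 becomes -1 because rows 3 and 5 of the 0/1 matrix meet in 2 modulo 4
  columns; \<open>line_entry\<close> and \<open>shadow_entry\<close> give vectors of norm 3 in the lattice and of
  norm 21/4 in its shadow.\<close>

definition columns :: "nat list" where
  "columns = [1, 2, 4, 5, 6, 8, 10, 12, 14, 16, 17, 18, 20, 21, 23, 24, 25, 28, 29, 30, 31, 32,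
    34, 36, 37, 40, 42, 43, 46, 48, 50, 52, 53, 54, 55, 58, 60]"

definition entry :: "nat \<Rightarrow> nat \<Rightarrow> int" where
  "entry a s = (if bit s a then if (a, s) = (5, 40) then - 1 else 1 else 0)"

definition shadow_entry :: "nat \<Rightarrow> int" where
  "shadow_entry s = (if bit s 1 then 0 else if s = 53 then - 1 else 1)"

definition line_entry :: "nat \<Rightarrow> int" where
  "line_entry s = of_bool (s \<in> {1, 4, 5})"

section \<open>Verification of the code by finite computation\<close>

lemma distinct_columns: "distinct columns"
  by (simp add: columns_def)

lemma length_columns: "length columns = 37"
  by (simp add: columns_def)

lemma column_less: "s \<in> set columns \<Longrightarrow> s < 2 ^ 6"
  by (auto simp: columns_def)

text \<open>These columns are the unit vectors; they provide the pivots.\<close>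

lemma power_in_columns: "a < 6 \<Longrightarrow> 2 ^ a \<in> set columns"
  by (auto simp: columns_def numeral_eq_Suc less_Suc_eq)

lemma less_6_iff: "a < 6 \<longleftrightarrow> a \<in> {0, 1, 2, 3, 4, 5::nat}"
  by auto

lemma odd_entry_iff: "odd (entry a s) \<longleftrightarrow> bit s a"
  by (simp add: entry_def)

lemma entry_orth:
  assumes "a < 6" "b < 6"
  shows "4 dvd (\<Sum>s\<leftarrow>columns. entry a s * entry b s)"
proof -
  have "\<forall>a\<in>{0, 1, 2, 3, 4, 5}. \<forall>b\<in>{0, 1, 2, 3, 4, 5}. 4 dvd (\<Sum>s\<leftarrow>columns. entry a s * entry b s)"
    by (simp add: columns_def entry_def bit_Suc_0_iff)
  then show ?thesis using assms unfolding less_6_iff by blast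
qed

text \<open>With all signs positive, rows 0, 2, 4 and 5 would give 4 modulo 8. Column 53, binary
  110101, lies in exactly these rows among the six, and its sign -1 corrects all four.\<close>

lemma shadow_entry_row:
  assumes "a < 6"
  shows "8 dvd (\<Sum>s\<leftarrow>columns. (2 * shadow_entry s - entry a s) * entry a s)"
proof -
  have "\<forall>a\<in>{0, 1, 2, 3, 4, 5}. 8 dvd (\<Sum>s\<leftarrow>columns. (2 * shadow_entry s - entry a s) * entry a s)"
    by (simp add: columns_def entry_def shadow_entry_def bit_Suc_0_iff)
  then show ?thesis using assms unfolding less_6_iff by blast
qed

text \<open>Row 1 has weight 16, and the remaining 21 columns carry entries 1 or -1.\<close>

lemma shadow_entry_norm: "(\<Sum>s\<leftarrow>columns. shadow_entry s * shadow_entry s) = 21"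
  by (simp add: columns_def shadow_entry_def bit_Suc_0_iff)

text \<open>The exclusive or of 1 and 4 is 5, so every bit occurs an even number of times among
  these three columns.\<close>

lemma line_entry_row:
  assumes "a < 6"
  shows "even (\<Sum>s\<leftarrow>columns. entry a s * line_entry s)"
proof -
  have "\<forall>a\<in>{0, 1, 2, 3, 4, 5}. even (\<Sum>s\<leftarrow>columns. entry a s * line_entry s)"
    by (simp add: columns_def entry_def line_entry_def bit_Suc_0_iff)
  then show ?thesis using assms unfolding less_6_iff by blast
qed

lemma line_entry_norm: "(\<Sum>s\<leftarrow>columns. line_entry s * line_entry s) = 3"
  by (simp add: columns_def line_entry_def)

text \<open>The booleans select the rows that are added; all 64 residue words are
  enumerated.\<close>

lemma weight_of_bits:
  "length (filter (\<lambda>s. (b0 \<and> bit s 0) \<noteq> ((b1 \<and> bit s 1) \<noteq> ((b2 \<and> bit s 2) \<noteq>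
    ((b3 \<and> bit s 3) \<noteq> ((b4 \<and> bit s 4) \<noteq> (b5 \<and> bit s 5)))))) columns) \<in> {0, 12, 16, 20}"
  by (cases b0; cases b1; cases b2; cases b3; cases b4; cases b5;
      simp add: columns_def bit_Suc_0_iff)

lemma weight: "length (filter (\<lambda>s. odd (\<Sum>a<6. m a * entry a s)) columns) \<in> {0, 12, 16, 20}"
proof -
  have "odd (\<Sum>a<6. m a * entry a s) \<longleftrightarrow> (odd (m 0) \<and> bit s 0) \<noteq> ((odd (m 1) \<and> bit s 1) \<noteq>
      ((odd (m 2) \<and> bit s 2) \<noteq> ((odd (m 3) \<and> bit s 3) \<noteq> ((odd (m 4) \<and> bit s 4) \<noteq>
      (odd (m 5) \<and> bit s 5)))))" for s
  proof -
    have "{..<6} = {0, 1, 2, 3, 4, 5::nat}" by auto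
    then have "(\<Sum>a<6. m a * entry a s) = m 0 * entry 0 s + (m 1 * entry 1 s + (m 2 * entry 2 s +
        (m 3 * entry 3 s + (m 4 * entry 4 s + m 5 * entry 5 s))))"
      by simp
    then show ?thesis
      by (simp only: odd_add even_mult_iff de_Morgan_disj odd_entry_iff)
  qed
  then show ?thesis by (simp only: weight_of_bits)
qed

section \<open>Transfer to 37 coordinates and the two minima\<close>

theorem proposition4p3:
  "\<exists>L :: (real ^ 37) set. unimodular_lattice L \<and> min_norm L = 3 \<and> shadow_sigma L = 21"
proof -
  have "card (UNIV :: 37 set) = card (set columns)"
    using distinct_card[OF distinct_columns] length_columns by simp
  \<comment> \<open>Labelling coordinates by columns turns sums and cardinalities over the type
    \<open>37\<close> into evaluations along the list.\<close>
  then obtain p :: "37 \<Rightarrow> nat" where p: "bij_betw p UNIV (set columns)"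
    using finite_same_card_bij[of "UNIV :: 37 set" "set columns"] by auto
  have inj: "p i = p j \<longleftrightarrow> i = j" for i j
    using p by (auto simp: bij_betw_def inj_eq)
  have p_in: "p i \<in> set columns" for i
    using p by (auto simp: bij_betw_def)
  have sum_p: "(\<Sum>i\<in>UNIV. f (p i)) = (\<Sum>s\<leftarrow>columns. f s)" for f :: "nat \<Rightarrow> int"
    using sum.reindex_bij_betw[OF p, of f] distinct_columns
    by (simp add: sum.distinct_set_conv_list)
  have card_p: "card {i. P (p i)} = length (filter P columns)" for P
  proof -
    have "p ` {i. P (p i)} = set (filter P columns)"
      using p by (auto simp: bij_betw_def)
    moreover have "card (p ` {i. P (p i)}) = card {i. P (p i)}"
      by (intro card_image) (auto simp: inj_on_def inj)
    ultimately show ?thesis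
      using distinct_card[of "filter P columns"] distinct_columns by simp
  qed
  define G where "G = (\<lambda>a i. entry a (p i))"
  interpret z4_code G 6 "\<lambda>a. inv_into UNIV p (2 ^ a)"
  proof
    fix a b :: nat
    assume ab: "a < 6" "b < 6"
    show "4 dvd dot (G a) (G b)"
      using entry_orth[OF ab] by (simp add: G_def dot_def sum_p[of "\<lambda>s. entry a s * entry b s"])
    have "p (inv_into UNIV p (2 ^ b)) = 2 ^ b"
      using p power_in_columns[OF ab(2)] by (intro f_inv_into_f) (auto simp: bij_betw_def)
    then show "G a (inv_into UNIV p (2 ^ b)) = of_bool (a = b)"
      using ab by (auto simp: G_def entry_def bit_exp_iff less_6_iff)
  qed
  have wt: "card {i. odd (comb m i)} \<in> {0, 12, 16, 20}" for m
    using weight[of m] unfolding comb_def unfolding G_def card_p[of "\<lambda>s. odd (\<Sum>a<6. m a * entry a s)"] .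
  have ge_3: "3 \<le> x \<bullet> x" if "x \<in> lattice" "x \<noteq> 0" for x
  proof (rule lattice_norm_ge_3[OF _ _ _ that])
    show "card {i. odd (comb m i)} = 0 \<or> 12 \<le> card {i. odd (comb m i)}" for m
      using wt[of m] by auto
    \<comment> \<open>Numbers below 64 are determined by their six lowest bits. Since 0 is not a
      column, comparison with 0 shows that every column is nonzero.\<close>
    have bits: "\<exists>a<6. bit s a \<noteq> bit t a" if "s < 2 ^ 6" "t < 2 ^ 6" "s \<noteq> t" for s t :: nat
      using that by (metis bit_eq_iff bit_take_bit_iff take_bit_nat_eq_self)
    show "\<exists>a<6. odd (G a i)" for i
      using bits[of "p i" 0] column_less[OF p_in[of i]] p_in[of i]
      by (fastforce simp: G_def odd_entry_iff columns_def)
    show "\<exists>a<6. odd (G a i + G a j)" if ij: "i \<noteq> j" for i j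
    proof -
      obtain a where "a < 6" "bit (p i) a \<noteq> bit (p j) a"
        using bits[OF column_less[OF p_in[of i]] column_less[OF p_in[of j]]] ij inj[of i j] by blast
      then have "odd (G a i + G a j)"
        unfolding G_def odd_add odd_entry_iff by blast
      with \<open>a < 6\<close> show ?thesis by blast
    qed
  qed
  define u where "u = (\<lambda>i. line_entry (p i))"
  have u: "torsion u" "dot u u = 3"
  proof -
    have "even (dot (G a) u)" if "a < 6" for a
      unfolding dot_def u_def G_def using line_entry_row[OF that]
        sum_p[of "\<lambda>s. entry a s * line_entry s"] by simp
    then show "torsion u" unfolding torsion_def by blast
    show "dot u u = 3"
      unfolding dot_def u_def using line_entry_norm
        sum_p[of "\<lambda>s. line_entry s * line_entry s"] by simp
  qed
  have "min_norm lattice = 3"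
    unfolding min_norm_def
  proof (rule least_norm_eqI)
    define x where "x = (1/2) *\<^sub>R ivec (\<lambda>i. 2 * u i)"
    show "x \<bullet> x = 3"
      unfolding x_def inner_half_ivec using u(2) by (simp add: dot_linear)
    moreover have "x \<in> lattice"
      using double_in_words[OF u(1)] by (simp add: x_def lattice_def)
    ultimately show "x \<in> lattice - {0}" by auto
  qed (use ge_3 in auto)
  moreover have "least_norm (shadow lattice) = 21 / 4"
  proof (rule least_norm_eqI)
    define t where "t = (\<lambda>i. shadow_entry (p i))"
    \<comment> \<open>The witness vanishes exactly on the support of row 1 and is odd elsewhere, so
      adding this row makes every entry odd.\<close>
    have row: "comb (\<lambda>a. of_bool (a = 1)) i = entry 1 (p i)" for i
      unfolding comb_def unfolding G_def
      by (simp add: of_bool_def if_distrib if_distribR cong: if_cong)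
    show "(1/2) *\<^sub>R ivec t \<in> shadow lattice"
    proof (rule in_shadow_latticeI[OF _ _ u(1)])
      show "8 dvd 2 * dot t (G a) - dot (G a) (G a)" if "a < 6" for a
      proof -
        have "2 * dot t (G a) - dot (G a) (G a)
            = (\<Sum>i\<in>UNIV. (2 * shadow_entry (p i) - entry a (p i)) * entry a (p i))"
          by (simp add: t_def G_def dot_def sum_distrib_left left_diff_distrib sum_subtractf mult.assoc)
        then show ?thesis
          using shadow_entry_row[OF that]
            sum_p[of "\<lambda>s. (2 * shadow_entry s - entry a s) * entry a s"] by simp
      qed
      show "odd (t i + comb (\<lambda>a. of_bool (a = 1)) i)" for i
        unfolding row by (simp add: t_def shadow_entry_def entry_def)
    qed (use u(2) in simp)
    show "((1/2) *\<^sub>R ivec t) \<bullet> ((1/2) *\<^sub>R ivec t) = 21 / 4"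
      unfolding inner_half_ivec using shadow_entry_norm
      by (simp add: t_def dot_def sum_p[of "\<lambda>s. shadow_entry s * shadow_entry s"])
  next
    fix w assume "w \<in> shadow lattice"
    then obtain t m where t: "w = (1/2) *\<^sub>R ivec t" "\<And>i. odd (t i + comb m i)"
      "dot t t mod 8 = int CARD(37) mod 8"
      by (rule shadow_lattice) blast
    have "{i. odd (t i)} = - {i. odd (comb m i)}" using t(2) by auto
    then have "card {i. odd (t i)} = 37 - card {i. odd (comb m i)}"
      by (simp add: Compl_eq_Diff_UNIV card_Diff_subset)
    then have "17 \<le> dot t t" using wt[of m] card_odd_le_dot[of t] by auto
    \<comment> \<open>Both 37 and 21 are 5 modulo 8, while none of 17, 18, 19, 20 is.\<close>
    with t(3) have "21 \<le> dot t t" by simp presburger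
    then show "21 / 4 \<le> w \<bullet> w" unfolding t(1) inner_half_ivec by simp
  qed
  ultimately show ?thesis
    using unimodular_lattice by (intro exI[of _ lattice]) (simp add: shadow_sigma_def)
qed

end
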